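(* For every $\alpha>(1+\mathsf{e}^{-2})/2$, there is no random-order contention resolution scheme for vertex arrivals that is $\alpha$-selectable on all bipartite graphs $G$ with all fractional matchings $\bm{x}$ of $G$.
   Context: Graph $G=(V,E)$; $N(v)$ denotes the neighbours of $v$. A fractional matching is $\bm{x}=(x_e)_{e\in E}\in[0,1]^E$ with $\sum_{e\ni v}x_e\le 1$ for all $v\in V$. Random-order vertex arrival model: independently for each $v\in V$, draw $F_v\in N(v)\cup\{\perp\}$ with $\mathbb{P}[F_v=u]=x_{u,v}$ for $u\in N(v)$ and $\mathbb{P}[F_v=\perp]=1-\sum_{u\in N(v)}x_{u,v}$, and an arrival time $Y_v$ uniform on $[0,1]$, all independent. An edge $(u,v)$ is active if ($F_v=u$ and $Y_u<Y_v$) or ($F_u=v$ and $Y_v<Y_u$). An RCRS knows $G,\bm{x}$, processes vertices in increasing order of arrival, and when $v$ arrives learns which edge (if any) from $v$ to earlier vertices is active; it may (possibly randomly) irrevocably add that edge to its matching $\mathcal{M}$ if $\mathcal{M}$ remains a matching. It is $\alpha$-selectable on a class of instances if $\mathbb{P}[e\in\mathcal{M}]\ge\alpha x_e$ for all $e\in E$ for every instance in the class. *)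

theory Defs
  imports "HOL-Probability.Probability"
begin

text \<open>Finite simple graphs on natural-number vertices; edges are two-element vertex sets.\<close>

definition graph :: "nat set \<Rightarrow> nat set set \<Rightarrow> bool" where
  "graph V E \<longleftrightarrow> finite V \<and> (\<forall>e\<in>E. e \<subseteq> V \<and> card e = 2)"

definition bipartite :: "nat set \<Rightarrow> nat set set \<Rightarrow> bool" where
  "bipartite V E \<longleftrightarrow>
     (\<exists>A B. A \<union> B = V \<and> A \<inter> B = {} \<and> (\<forall>e\<in>E. \<exists>a\<in>A. \<exists>b\<in>B. e = {a, b}))"

definition nbrs :: "nat set set \<Rightarrow> nat \<Rightarrow> nat set" where
  "nbrs E v = {u. {u, v} \<in> E}"

definition matching :: "nat set set \<Rightarrow> bool" where
  "matching M \<longleftrightarrow> (\<forall>e\<in>M. \<forall>f\<in>M. e \<noteq> f \<longrightarrow> e \<inter> f = {})"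

definition fractional_matching :: "nat set \<Rightarrow> nat set set \<Rightarrow> (nat set \<Rightarrow> real) \<Rightarrow> bool" where
  "fractional_matching V E x \<longleftrightarrow>
     x \<in> E \<rightarrow>\<^sub>E {0..1} \<and> (\<forall>v\<in>V. (\<Sum>e\<in>{e\<in>E. v \<in> e}. x e) \<le> 1)"

text \<open>The law of \<open>F\<^sub>v\<close>, with \<open>None\<close> for \<open>\<bottom>\<close>. For a fractional matching \<open>x\<close> of a graph and a
  vertex \<open>v\<close>, the weights do define a distribution: see \<open>pmf_choice_pmf\<close> below.\<close>

definition choice_pmf :: "nat set set \<Rightarrow> (nat set \<Rightarrow> real) \<Rightarrow> nat \<Rightarrow> nat option pmf" where
  "choice_pmf E x v = embed_pmf (\<lambda>w. case w of
       None \<Rightarrow> 1 - (\<Sum>u\<in>nbrs E v. x {u, v})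
     | Some u \<Rightarrow> if u \<in> nbrs E v then x {u, v} else 0)"

definition active ::
    "nat set set \<Rightarrow> (nat \<Rightarrow> nat option) \<Rightarrow> (nat \<Rightarrow> real) \<Rightarrow> nat \<Rightarrow> nat \<Rightarrow> bool" where
  "active E F Y u v \<longleftrightarrow> {u, v} \<in> E \<and>
     ((F v = Some u \<and> Y u < Y v) \<or> (F u = Some v \<and> Y v < Y u))"

text \<open>What is revealed when \<open>v\<close> arrives: the vertex, its arrival time, and the other endpoint of
  the active edge (if any) from \<open>v\<close> to an earlier vertex; there is at most one such edge, since
  for \<open>Y u < Y v\<close> being active means \<open>F v = Some u\<close>.\<close>

type_synonym arrival = "nat \<times> real \<times> nat option"

definition active_earlier ::
    "nat set set \<Rightarrow> (nat \<Rightarrow> nat option) \<Rightarrow> (nat \<Rightarrow> real) \<Rightarrow> nat \<Rightarrow> nat option" where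
  "active_earlier E F Y v =
     (if \<exists>u. Y u < Y v \<and> active E F Y u v
      then Some (THE u. Y u < Y v \<and> active E F Y u v) else None)"

text \<open>Vertices by increasing arrival time; ties, a null event, are broken by vertex number.\<close>

definition arrivals ::
    "nat set \<Rightarrow> nat set set \<Rightarrow> (nat \<Rightarrow> nat option) \<Rightarrow> (nat \<Rightarrow> real) \<Rightarrow> arrival list" where
  "arrivals V E F Y =
     map (\<lambda>v. (v, Y v, active_earlier E F Y v)) (sort_key Y (sorted_list_of_set V))"

text \<open>A randomized online algorithm: a random seed, independent of the instance's randomness, and
  a decision, given the seed and the arrivals up to and including the current one, whether to
  select the currently revealed active edge. Past decisions are functions of the same data, so
  they need not be passed explicitly.\<close>

record 's algorithm =
  seed_space :: "'s measure"
  accept :: "'s \<Rightarrow> arrival list \<Rightarrow> bool"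

text \<open>Arguments of \<open>run\<close>: decision rule, past arrivals, arrivals to come, current matching.\<close>

fun run :: "(arrival list \<Rightarrow> bool) \<Rightarrow> arrival list \<Rightarrow> arrival list \<Rightarrow> nat set set \<Rightarrow> nat set set" where
  "run d past [] M = M"
| "run d past ((v, t, w) # rest) M =
     run d (past @ [(v, t, w)]) rest
       (case w of
          None \<Rightarrow> M
        | Some u \<Rightarrow>
            if d (past @ [(v, t, w)]) \<and> matching (insert {u, v} M) then insert {u, v} M else M)"

definition prob_model ::
    "nat set \<Rightarrow> nat set set \<Rightarrow> (nat set \<Rightarrow> real) \<Rightarrow> 's measure
       \<Rightarrow> ((nat \<Rightarrow> nat option) \<times> (nat \<Rightarrow> real) \<times> 's) measure" where
  "prob_model V E x S =
     (\<Pi>\<^sub>M v\<in>V. measure_pmf (choice_pmf E x v)) \<Otimes>\<^sub>M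
     ((\<Pi>\<^sub>M v\<in>V. uniform_measure lborel {0..1}) \<Otimes>\<^sub>M S)"

definition selected ::
    "nat set \<Rightarrow> nat set set \<Rightarrow> 's algorithm
       \<Rightarrow> (nat \<Rightarrow> nat option) \<times> (nat \<Rightarrow> real) \<times> 's \<Rightarrow> nat set set" where
  "selected V E a = (\<lambda>(F, Y, s). run (accept a s) [] (arrivals V E F Y) {})"

text \<open>A scheme knows \<open>G\<close> and \<open>x\<close>: it provides an algorithm for each instance. The only regularity
  required is that the selected matching be a random variable.\<close>

type_synonym 's scheme = "nat set \<Rightarrow> nat set set \<Rightarrow> (nat set \<Rightarrow> real) \<Rightarrow> 's algorithm"

definition rcrs :: "'s scheme \<Rightarrow> bool" where
  "rcrs A \<longleftrightarrow> (\<forall>V E x. graph V E \<longrightarrow> fractional_matching V E x \<longrightarrow>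
     prob_space (seed_space (A V E x)) \<and>
     selected V E (A V E x)
       \<in> prob_model V E x (seed_space (A V E x)) \<rightarrow>\<^sub>M count_space (Pow E))"

definition selectable_on ::
    "real \<Rightarrow> 's scheme \<Rightarrow> (nat set \<times> nat set set \<times> (nat set \<Rightarrow> real)) set \<Rightarrow> bool" where
  "selectable_on \<alpha> A C \<longleftrightarrow> (\<forall>(V, E, x)\<in>C. \<forall>e\<in>E.
     measure (prob_model V E x (seed_space (A V E x)))
       {\<omega> \<in> space (prob_model V E x (seed_space (A V E x))). e \<in> selected V E (A V E x) \<omega>}
     \<ge> \<alpha> * x e)"

definition bipartite_class :: "(nat set \<times> nat set set \<times> (nat set \<Rightarrow> real)) set" where
  "bipartite_class = {(V, E, x). graph V E \<and> bipartite V E \<and> fractional_matching V E x}"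

lemma pmf_choice_pmf:
  assumes G: "graph V E" and x: "fractional_matching V E x" and v: "v \<in> V"
  shows "pmf (choice_pmf E x v) w = (case w of
       None \<Rightarrow> 1 - (\<Sum>u\<in>nbrs E v. x {u, v})
     | Some u \<Rightarrow> if u \<in> nbrs E v then x {u, v} else 0)" (is "_ = ?p w")
proof -
  have sub: "nbrs E v \<subseteq> V" using G by (auto simp: nbrs_def graph_def)
  then have fin: "finite (nbrs E v)" using G finite_subset by (auto simp: graph_def)
  have inj: "inj_on (\<lambda>u. {u, v}) (nbrs E v)"
    by (auto simp: inj_on_def doubleton_eq_iff)
  have im: "(\<lambda>u. {u, v}) ` nbrs E v = {e\<in>E. v \<in> e}"
  proof (intro set_eqI iffI)
    fix e assume "e \<in> {e\<in>E. v \<in> e}"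
    then have e: "e \<in> E" "v \<in> e" "card e = 2" using G by (auto simp: graph_def)
    then obtain u where "e = {u, v}" by (auto simp: card_2_iff insert_commute)
    with e show "e \<in> (\<lambda>u. {u, v}) ` nbrs E v" by (auto simp: nbrs_def)
  qed (auto simp: nbrs_def)
  have le: "(\<Sum>u\<in>nbrs E v. x {u, v}) \<le> 1"
  proof -
    have "(\<Sum>u\<in>nbrs E v. x {u, v}) = (\<Sum>e\<in>{e\<in>E. v \<in> e}. x e)"
      using sum.reindex[OF inj, of x] by (simp add: im o_def)
    then show ?thesis using x v by (simp add: fractional_matching_def)
  qed
  have nn: "u \<in> nbrs E v \<Longrightarrow> 0 \<le> x {u, v}" for u
    using x by (auto simp: nbrs_def fractional_matching_def PiE_def Pi_def)
  have p_nn: "0 \<le> ?p w" for w using le nn by (auto split: option.split)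
  define A where "A = insert None (Some ` nbrs E v)"
  have finA: "finite A" using fin by (simp add: A_def)
  have "(\<integral>\<^sup>+ w. ennreal (?p w) \<partial>count_space UNIV) = (\<Sum>w\<in>A. ennreal (?p w))"
    by (rule nn_integral_count_space'[OF finA]) (auto simp: A_def split: option.splits if_splits)
  also have "\<dots> = ennreal (\<Sum>w\<in>A. ?p w)" by (rule sum_ennreal) (rule p_nn)
  also have "(\<Sum>w\<in>A. ?p w) = 1"
    using fin by (simp add: A_def sum.reindex)
  finally show ?thesis
    unfolding choice_pmf_def by (intro pmf_embed_pmf p_nn) simp
qed

lemma run_matching: "matching M \<Longrightarrow> matching (run d past rest M)"
  by (induction d past rest M rule: run.induct) (auto split: option.splits)

lemma selected_matching: "matching (selected V E a \<omega>)"
proof -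
  have "matching {}" by (simp add: matching_def)
  then show ?thesis by (cases \<omega>) (simp add: selected_def run_matching)
qed

end

theory Submission
  imports Defs
begin

text \<open>
  Take the complete bipartite graph with parts of size \<open>n\<close> and \<open>x = 1/n\<close> on every edge, so that
  \<open>\<alpha>\<close>-selectability forces an expected matching size of at least \<open>\<alpha> n\<close>. Fix the arrival times \<open>Y\<close>
  and the seed. When \<open>v\<close> arrives, \<open>F\<^sub>v\<close> is independent of the history and hits an unmatched earlier
  vertex with probability at most \<open>(r\<^sub>v - |M|)/n\<close>, where \<open>r\<^sub>v\<close> counts the earlier vertices on the other
  side. So one arrival replaces the expected size \<open>m\<close> by at most \<open>q m + r\<^sub>v/n\<close> with \<open>q = 1 - 1/n\<close>, and
  the final expected size is at most \<open>\<Sum>\<^sub>v q^#{w. Y\<^sub>v < Y\<^sub>w} r\<^sub>v/n\<close>. Integrating over \<open>Y\<close> turns this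
  into \<open>2n \<integral> y (1 - (1 - y)/n)^(2n - 2) dy\<close> over \<open>[0,1]\<close>, which is at most
  \<open>n exp (2/n) \<cdot> 2 \<integral> y exp (-2 (1 - y)) dy = n exp (2/n) (1 + exp (-2))/2\<close>; let \<open>n\<close> tend to infinity.
\<close>

section \<open>The complete bipartite graph with uniform weights\<close>

definition biclique :: "nat \<Rightarrow> nat set set" where
  "biclique n = (\<lambda>(a, b). {a, b}) ` ({..<n} \<times> {n..<2 * n})"

lemma bicliqueI: "a < n \<Longrightarrow> n \<le> b \<Longrightarrow> b < 2 * n \<Longrightarrow> {a, b} \<in> biclique n"
  unfolding biclique_def by (rule image_eqI[of _ _ "(a, b)"]) auto

lemma bicliqueE:
  assumes "e \<in> biclique n"
  obtains a b where "e = {a, b}" "a < n" "n \<le> b" "b < 2 * n"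
  using assms by (auto simp: biclique_def)

text \<open>For \<open>v < 2 * n\<close> this is the neighbourhood of \<open>v\<close> in
  \<open>biclique n\<close>. Larger \<open>v\<close> get a default value of the same size, so
  \<open>card_opposite\<close> holds without a side condition.\<close>

definition opposite :: "nat \<Rightarrow> nat \<Rightarrow> nat set" where
  "opposite n v = (if v < n then {n..<2 * n} else {..<n})"

lemma finite_opposite [simp]: "finite (opposite n v)"
  by (simp add: opposite_def)

lemma card_opposite [simp]: "card (opposite n v) = n"
  by (simp add: opposite_def)

lemma opposite_bound: "u \<in> opposite n v \<Longrightarrow> u < 2 * n \<and> u \<noteq> v"
  by (auto simp: opposite_def split: if_splits)

lemma edge_biclique_iff: "{u, v} \<in> biclique n \<longleftrightarrow> v < 2 * n \<and> u \<in> opposite n v"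
proof
  assume "{u, v} \<in> biclique n"
  then obtain a b where "{u, v} = {a, b}" "a < n" "n \<le> b" "b < 2 * n"
    by (rule bicliqueE)
  then show "v < 2 * n \<and> u \<in> opposite n v"
    by (auto simp: opposite_def doubleton_eq_iff)
next
  assume "v < 2 * n \<and> u \<in> opposite n v"
  then show "{u, v} \<in> biclique n"
    using bicliqueI[of u n v] bicliqueI[of v n u]
    by (auto simp: opposite_def insert_commute split: if_splits)
qed

text \<open>Either side of the bipartition is a vertex cover. This is what makes every edge already
  selected use up one potential partner of \<open>v\<close>.\<close>

lemma biclique_edge_meets_opposite:
  assumes "e \<in> biclique n"
  shows "e \<inter> opposite n v \<noteq> {}"
  using assms by (rule bicliqueE) (auto simp: opposite_def)

lemma finite_biclique [simp]: "finite (biclique n)"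
  by (simp add: biclique_def)

lemma card_biclique: "card (biclique n) = n * n"
proof -
  have "inj_on (\<lambda>(a, b). {a, b}) ({..<n} \<times> {n..<2 * n})"
    by (auto simp: inj_on_def doubleton_eq_iff)
  then show ?thesis
    by (simp add: biclique_def card_image)
qed

lemma graph_biclique: "graph {..<2 * n} (biclique n)"
  by (auto simp: graph_def elim!: bicliqueE)

lemma bipartite_biclique: "bipartite {..<2 * n} (biclique n)"
  unfolding bipartite_def
proof (intro exI conjI ballI)
  show "{..<n} \<union> {n..<2 * n} = {..<2 * n}" "{..<n} \<inter> {n..<2 * n} = {}"
    by auto
  show "\<exists>a\<in>{..<n}. \<exists>b\<in>{n..<2 * n}. e = {a, b}" if "e \<in> biclique n" for e
    using that by (rule bicliqueE) (metis atLeastLessThan_iff lessThan_iff)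
qed

lemma incident_biclique:
  assumes "v < 2 * n"
  shows "{e \<in> biclique n. v \<in> e} = (\<lambda>u. {u, v}) ` opposite n v"
proof (intro equalityI subsetI)
  fix e assume "e \<in> {e \<in> biclique n. v \<in> e}"
  then have e: "e \<in> biclique n" "v \<in> e"
    by auto
  from e(1) obtain a b where "e = {a, b}"
    by (rule bicliqueE)
  with e(2) have "e = {b, v} \<or> e = {a, v}"
    by blast
  with e(1) show "e \<in> (\<lambda>u. {u, v}) ` opposite n v"
    by (auto simp: edge_biclique_iff)
next
  fix e assume "e \<in> (\<lambda>u. {u, v}) ` opposite n v"
  then show "e \<in> {e \<in> biclique n. v \<in> e}"
    using assms by (auto simp: edge_biclique_iff)
qed

text \<open>Every vertex has degree \<open>n\<close>, so the weights around it sum to exactly 1. The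
  weight function is a restricted one because \<open>fractional_matching\<close> asks for
  extensionality.\<close>

lemma fractional_matching_biclique:
  assumes "0 < n"
  shows "fractional_matching {..<2 * n} (biclique n) (\<lambda>e\<in>biclique n. 1 / real n)"
proof -
  have "(\<Sum>e\<in>{e \<in> biclique n. v \<in> e}. (\<lambda>e\<in>biclique n. 1 / real n) e) \<le> 1"
    if "v < 2 * n" for v
  proof -
    have "inj_on (\<lambda>u. {u, v}) (opposite n v)"
      by (auto simp: inj_on_def doubleton_eq_iff)
    then have "card {e \<in> biclique n. v \<in> e} = n"
      by (simp add: incident_biclique[OF that] card_image)
    then show ?thesis
      using assms by simp
  qed
  then show ?thesis
    using assms by (auto simp: fractional_matching_def)
qed

lemma pmf_choice_biclique:
  assumes "0 < n" "v < 2 * n"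
  shows "pmf (choice_pmf (biclique n) (\<lambda>e\<in>biclique n. 1 / real n) v) (Some u) \<le> 1 / real n"
  using assms pmf_choice_pmf[OF graph_biclique fractional_matching_biclique, of n v "Some u"]
  by (auto simp: nbrs_def)

section \<open>Revealed edges as functions of the choices\<close>

text \<open>Once \<open>Y u < Y v\<close>, the second disjunct of \<open>active\<close> is
  impossible, so the edge revealed at \<open>v\<close> depends on \<open>F\<close> through
  \<open>F v\<close> alone. Hence the choice of one vertex can be integrated out separately from the
  others.\<close>

lemma active_earlier_eq:
  "active_earlier E F Y v = (case F v of None \<Rightarrow> None
     | Some u \<Rightarrow> if {u, v} \<in> E \<and> Y u < Y v then Some u else None)"
proof -
  have *: "Y u < Y v \<and> active E F Y u v \<longleftrightarrow> {u, v} \<in> E \<and> Y u < Y v \<and> F v = Some u" for u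
    by (auto simp: active_def)
  show ?thesis
  proof (cases "F v")
    case None
    then show ?thesis
      unfolding active_earlier_def * by simp
  next
    case (Some a)
    then have "(THE u. {u, v} \<in> E \<and> Y u < Y v \<and> F v = Some u) = a" if "{a, v} \<in> E" "Y a < Y v"
      using that by (intro the_equality) auto
    with Some show ?thesis
      unfolding active_earlier_def * by auto
  qed
qed

text \<open>A finite product of countable discrete spaces is discrete. This settles measurability in
  \<open>F\<close> of a run whose decision rule is arbitrary.\<close>

lemma measurable_PiM_pmf_countable:
  fixes p :: "'a \<Rightarrow> 'b::countable pmf"
  assumes "finite I" "\<And>x. f x \<in> space N"
  shows "f \<in> PiM I (\<lambda>i. measure_pmf (p i)) \<rightarrow>\<^sub>M N"
proof -
  have "sets (PiM I (\<lambda>i. measure_pmf (p i))) = sets (PiM I (\<lambda>i. count_space UNIV))"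
    by (intro sets_PiM_cong) simp_all
  also have "\<dots> = sets (count_space (PiE I (\<lambda>_. UNIV)))"
    by (subst count_space_PiM_finite) (use assms in auto)
  finally have "PiM I (\<lambda>i. measure_pmf (p i)) \<rightarrow>\<^sub>M N = count_space (PiE I (\<lambda>_. UNIV)) \<rightarrow>\<^sub>M N"
    by (rule measurable_cong_sets) simp
  then show ?thesis
    using assms(2) by (simp add: Pi_def)
qed

section \<open>Expected matching size for fixed arrival times\<close>

text \<open>Edges of a matching are disjoint, so picking one point of \<open>A\<close> in each edge
  is injective.\<close>

lemma card_matching_le_covered:
  assumes "matching M" "finite A" "\<And>e. e \<in> M \<Longrightarrow> e \<inter> A \<noteq> {}"
  shows "card M \<le> card (A \<inter> \<Union>M)"
proof -
  define h where "h e = (SOME x. x \<in> e \<inter> A)" for e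
  have h: "h e \<in> e \<inter> A" if "e \<in> M" for e
  proof -
    have "\<exists>x. x \<in> e \<inter> A"
      using assms(3)[OF that] by blast
    then show ?thesis
      unfolding h_def by (rule someI_ex)
  qed
  have "inj_on h M"
  proof (rule inj_onI)
    fix e f assume "e \<in> M" "f \<in> M" "h e = h f"
    then have "e \<inter> f \<noteq> {}"
      using h[of e] h[of f] by auto
    then show "e = f"
      using assms(1) \<open>e \<in> M\<close> \<open>f \<in> M\<close> unfolding matching_def by blast
  qed
  moreover have "h ` M \<subseteq> A \<inter> \<Union>M"
    using h by auto
  ultimately show ?thesis
    using assms(2) card_inj_on_le[of h M "A \<inter> \<Union>M"] by auto
qed

text \<open>Unrolls the recursion \<open>m\<close> to \<open>q * m + r / n\<close> along the
  remaining arrivals: the contribution of \<open>v\<close> is discounted by one factor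
  \<open>q\<close> for each later arrival. Past and matching are generalised in the induction. Ties
  in \<open>Y\<close> are covered, since partners are counted with \<le> and later vertices with <,
  and both choices can only enlarge the bound.\<close>

lemma expected_card_run_le:
  fixes p :: "nat \<Rightarrow> nat option pmf" and q :: real
  assumes n: "0 < n" and q: "q = 1 - 1 / real n"
    and p: "\<And>v u. v \<in> set vs \<Longrightarrow> pmf (p v) (Some u) \<le> 1 / real n"
    and "distinct vs" "sorted (map Y vs)"
    and "matching M" "M \<subseteq> biclique n"
    and "\<And>e w v. e \<in> M \<Longrightarrow> w \<in> e \<Longrightarrow> v \<in> set vs \<Longrightarrow> Y w \<le> Y v"
  shows "(\<integral>\<^sup>+F. ennreal (card (run d past
             (map (\<lambda>v. (v, Y v, active_earlier (biclique n) F Y v)) vs) M))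
           \<partial>PiM (set vs) (\<lambda>v. measure_pmf (p v)))
    \<le> ennreal (q ^ length vs * card M
        + (\<Sum>v\<in>set vs. q ^ card {w \<in> set vs. Y v < Y w}
             * (card {u \<in> opposite n v. Y u \<le> Y v} / n)))"
  using p assms(4-)
proof (induction vs arbitrary: past M)
  case Nil
  interpret prob_space "PiM {} (\<lambda>v. measure_pmf (p v))"
    by (rule prob_space_PiM) simp
  show ?case by (simp add: emeasure_space_1)
next
  case (Cons v vs)
  interpret product_sigma_finite "\<lambda>v. measure_pmf (p v)"
    by unfold_locales
  let ?E = "biclique n"
  \<comment> \<open>With \<open>y\<close> as the value of \<open>F v\<close>, \<open>?ae y\<close>
    is what \<open>v\<close> reveals and \<open>?upd y\<close> the matching after its
    arrival.\<close>
  let ?ae = "\<lambda>y. case y of None \<Rightarrow> None | Some u \<Rightarrow> if {u, v} \<in> ?E \<and> Y u < Y v then Some u else None"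
  let ?upd = "\<lambda>y. case ?ae y of None \<Rightarrow> M | Some u \<Rightarrow>
     if d (past @ [(v, Y v, ?ae y)]) \<and> matching (insert {u, v} M) then insert {u, v} M else M"
  let ?r = "\<lambda>w. card {u \<in> opposite n w. Y u \<le> Y w} / n"
  define S where "S = (\<Sum>v\<in>set vs. q ^ card {w \<in> set vs. Y v < Y w} * ?r v)"
  define A where "A = {u \<in> opposite n v. Y u \<le> Y v}"
  \<comment> \<open>The partners still free: the matching can grow at \<open>v\<close> only if
    \<open>y = Some u\<close> with \<open>u\<close> in \<open>B\<close>.\<close>
  define B where "B = A - \<Union>M"
  have q01: "0 \<le> q" "q \<le> 1"
    using n by (auto simp: q)
  have finM: "finite M"
    using Cons.prems(5) finite_biclique by (rule finite_subset)
  have S0: "0 \<le> S"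
    unfolding S_def using q01 by (intro sum_nonneg) simp
  have finA: "finite A" "finite B"
    by (auto simp: A_def B_def)
  \<comment> \<open>Each edge of \<open>M\<close> has an end opposite \<open>v\<close>, and that end
    arrived no later than \<open>v\<close>; so \<open>M\<close> blocks at least
    \<open>card M\<close> vertices of \<open>A\<close>.\<close>
  have cardB: "card B + card M \<le> card A"
  proof -
    have "e \<inter> A \<noteq> {}" if "e \<in> M" for e
      using biclique_edge_meets_opposite[of e n v] Cons.prems(5,6) that by (fastforce simp: A_def)
    then have "card M \<le> card (A \<inter> \<Union>M)"
      using Cons.prems(4) finA by (intro card_matching_le_covered) auto
    moreover have "card A = card B + card (A \<inter> \<Union>M)"
      unfolding B_def using finA card_mono[of A "A \<inter> \<Union>M"]
      by (subst card_Diff_subset_Int) auto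
    ultimately show ?thesis by simp
  qed
  have card_upd: "card (?upd y) \<le> card M + indicator (Some ` B) y" for y
  proof -
    have "u \<in> B" if "{u, v} \<in> ?E" "Y u < Y v" "matching (insert {u, v} M)" "{u, v} \<notin> M" for u
    proof -
      have "u \<notin> \<Union>M"
        using that(3,4) by (force simp: matching_def)
      then show ?thesis
        using that by (auto simp: A_def B_def edge_biclique_iff)
    qed
    note new = this
    show ?thesis
    proof (cases "?upd y = M")
      case False
      then obtain u where u: "y = Some u" "{u, v} \<in> ?E" "Y u < Y v"
          "matching (insert {u, v} M)" "?upd y = insert {u, v} M"
        by (auto split: option.splits if_splits)
      moreover from this False have "{u, v} \<notin> M"
        by (metis insert_absorb)
      ultimately show ?thesis
        using finM new[of u] by (simp only: card_insert_disjoint) simp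
    qed simp
  qed
  \<comment> \<open>The induction hypothesis for fixed \<open>y\<close>. Its bound is affine in the
    current size with slope \<open>q ^ length vs\<close>, so a new edge costs at most that
    much.\<close>
  have step: "(\<integral>\<^sup>+F. ennreal (card (run d (past @ [(v, Y v, ?ae y)])
             (map (\<lambda>v. (v, Y v, active_earlier ?E F Y v)) vs) (?upd y)))
           \<partial>PiM (set vs) (\<lambda>v. measure_pmf (p v)))
       \<le> ennreal (q ^ length vs * card M + S) + ennreal (q ^ length vs) * indicator (Some ` B) y" for y
  proof -
    have "(\<integral>\<^sup>+F. ennreal (card (run d (past @ [(v, Y v, ?ae y)])
             (map (\<lambda>v. (v, Y v, active_earlier ?E F Y v)) vs) (?upd y)))
           \<partial>PiM (set vs) (\<lambda>v. measure_pmf (p v)))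
         \<le> ennreal (q ^ length vs * card (?upd y) + S)"
      unfolding S_def
    proof (rule Cons.IH)
      show "matching (?upd y)" "?upd y \<subseteq> ?E"
        using Cons.prems(4,5) by (auto split: option.splits)
      show "Y w \<le> Y v'" if "e \<in> ?upd y" "w \<in> e" "v' \<in> set vs" for e w v'
        using that Cons.prems(3,6) by (force split: option.splits if_splits)
    qed (use Cons.prems in auto)
    also have "\<dots> \<le> ennreal (q ^ length vs * (card M + indicator (Some ` B) y) + S)"
      using card_upd[of y] q01
      by (intro ennreal_leI add_mono mult_left_mono) (auto simp: indicator_def split: if_splits)
    also have "\<dots> = ennreal (q ^ length vs * card M + S) + ennreal (q ^ length vs) * indicator (Some ` B) y"
      using q01 S0 by (auto simp: indicator_def algebra_simps simp flip: ennreal_plus)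
    finally show ?thesis .
  qed
  have prob_B: "measure (measure_pmf (p v)) (Some ` B) \<le> card B / n"
  proof -
    have "measure (measure_pmf (p v)) (Some ` B) = (\<Sum>u\<in>B. pmf (p v) (Some u))"
      using finA by (simp add: measure_measure_pmf_finite sum.reindex)
    also have "\<dots> \<le> (\<Sum>u\<in>B. 1 / n)"
      using Cons.prems(1) by (intro sum_mono) auto
    finally show ?thesis by simp
  qed
  \<comment> \<open>Fubini: the choice of \<open>v\<close> becomes the outer variable, those of the
    later vertices the inner ones.\<close>
  have "(\<integral>\<^sup>+F. ennreal (card (run d past
             (map (\<lambda>v. (v, Y v, active_earlier ?E F Y v)) (v # vs)) M))
           \<partial>PiM (set (v # vs)) (\<lambda>v. measure_pmf (p v)))
     = (\<integral>\<^sup>+y. (\<integral>\<^sup>+F. ennreal (card (run d past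
             (map (\<lambda>w. (w, Y w, active_earlier ?E (F(v := y)) Y w)) (v # vs)) M))
           \<partial>PiM (set vs) (\<lambda>v. measure_pmf (p v))) \<partial>measure_pmf (p v))"
    unfolding list.set(2)
    by (rule product_nn_integral_insert_rev)
       (use Cons.prems in \<open>auto intro!: measurable_PiM_pmf_countable simp del: list.map run.simps\<close>)
  also have "\<dots> = (\<integral>\<^sup>+y. (\<integral>\<^sup>+F. ennreal (card (run d (past @ [(v, Y v, ?ae y)])
             (map (\<lambda>v. (v, Y v, active_earlier ?E F Y v)) vs) (?upd y)))
           \<partial>PiM (set vs) (\<lambda>v. measure_pmf (p v))) \<partial>measure_pmf (p v))"
  proof -
    \<comment> \<open>Later arrivals do not see \<open>y\<close>: what \<open>w\<close> reveals
      depends on \<open>F w\<close>, and \<open>v\<close> does not occur in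
      \<open>vs\<close>.\<close>
    have "map (\<lambda>w. (w, Y w, active_earlier ?E (F(v := y)) Y w)) vs
        = map (\<lambda>w. (w, Y w, active_earlier ?E F Y w)) vs" for F y
      using Cons.prems(2) by (auto simp: active_earlier_eq)
    moreover have "active_earlier ?E (F(v := y)) Y v = ?ae y" for F y
      by (simp add: active_earlier_eq)
    ultimately show ?thesis
      by (simp only: list.map run.simps)
  qed
  also have "\<dots> \<le> (\<integral>\<^sup>+y. ennreal (q ^ length vs * card M + S)
        + ennreal (q ^ length vs) * indicator (Some ` B) y \<partial>measure_pmf (p v))"
    by (intro nn_integral_mono step)
  also have "\<dots> = ennreal (q ^ length vs * card M + S
        + q ^ length vs * measure (measure_pmf (p v)) (Some ` B))"
    using q01 S0 by (simp add: nn_integral_add nn_integral_cmult measure_pmf.emeasure_eq_measure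
        flip: ennreal_plus ennreal_mult)
  also have "\<dots> \<le> ennreal (q ^ length (v # vs) * card M
        + (\<Sum>v'\<in>set (v # vs). q ^ card {w \<in> set (v # vs). Y v' < Y w} * ?r v'))"
  proof (rule ennreal_leI)
    define c where "c v' = q ^ card {w \<in> set (v # vs). Y v' < Y w} * ?r v'" for v'
    \<comment> \<open>Ties may leave fewer than \<open>length vs\<close> vertices strictly after
      \<open>v\<close>; as \<open>q\<close> \<le> 1, a smaller exponent only raises the
      bound.\<close>
    have "{w \<in> set (v # vs). Y v < Y w} \<subseteq> set vs"
      by auto
    then have "card {w \<in> set (v # vs). Y v < Y w} \<le> length vs"
      by (meson List.finite_set card_length card_mono order_trans)
    then have c_v: "q ^ length vs * ?r v \<le> c v"
      unfolding c_def using q01 by (intro mult_right_mono power_decreasing) auto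
    \<comment> \<open>By sortedness \<open>v\<close> is not strictly later than any
      \<open>v'\<close>, so the exponents of the remaining vertices do not change.\<close>
    have "{w \<in> set (v # vs). Y v' < Y w} = {w \<in> set vs. Y v' < Y w}" if "v' \<in> set vs" for v'
      using that Cons.prems(3) by force
    then have "S = sum c (set vs)"
      unfolding S_def c_def by (intro sum.cong) auto
    then have sum_c: "q ^ length vs * ?r v + S \<le> sum c (set (v # vs))"
      using c_v Cons.prems(2) by simp
    have "card B / n \<le> ?r v - card M / n"
      using cardB n by (simp add: A_def field_simps)
    then have "measure (measure_pmf (p v)) (Some ` B) \<le> ?r v - card M / n"
      using prob_B by linarith
    then have "q ^ length vs * card M + S + q ^ length vs * measure (measure_pmf (p v)) (Some ` B)
       \<le> q ^ length vs * card M + S + q ^ length vs * (?r v - card M / n)"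
      using q01 by (intro add_left_mono mult_left_mono) auto
    \<comment> \<open>The blocked partners pay here: \<open>card M - card M / n\<close> equals
      \<open>q * card M\<close>.\<close>
    also have "\<dots> = q ^ length (v # vs) * card M + (q ^ length vs * ?r v + S)"
      using n by (simp add: q field_simps)
    also have "\<dots> \<le> q ^ length (v # vs) * card M + sum c (set (v # vs))"
      using sum_c by simp
    finally show "q ^ length vs * card M + S + q ^ length vs * measure (measure_pmf (p v)) (Some ` B)
       \<le> q ^ length (v # vs) * card M
        + (\<Sum>v'\<in>set (v # vs). q ^ card {w \<in> set (v # vs). Y v' < Y w} * ?r v')"
      unfolding c_def .
  qed
  finally show ?case .
qed

section \<open>Integration over uniform arrival times\<close>

lemma nn_integral_uniform_unit:
  assumes "f \<in> borel_measurable borel"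
  shows "(\<integral>\<^sup>+z. f z \<partial>uniform_measure lborel {0..1::real})
    = (\<integral>\<^sup>+z. f z * indicator {0..1} z \<partial>lborel)"
  using assms by (subst nn_integral_uniform_measure) (auto simp: divide_ennreal_def)

lemma prob_space_uniform_unit: "prob_space (uniform_measure lborel {0..1::real})"
  by (rule prob_space_uniform_measure) auto

text \<open>The mean of a single factor, once the arrival time \<open>y\<close> of the reference
  vertex is fixed.\<close>

lemma nn_integral_uniform_unit_threshold:
  fixes a b y :: real
  assumes "0 \<le> a" "0 \<le> b" "0 \<le> y" "y \<le> 1"
  shows "(\<integral>\<^sup>+z. ennreal (if z \<le> y then a else b) \<partial>uniform_measure lborel {0..1})
    = ennreal (a * y + b * (1 - y))"
proof -
  have "(\<integral>\<^sup>+z. ennreal (if z \<le> y then a else b) \<partial>uniform_measure lborel {0..1})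
      = (\<integral>\<^sup>+z. ennreal (if z \<le> y then a else b) * indicator {0..1} z \<partial>lborel)"
    by (rule nn_integral_uniform_unit) measurable
  also have "\<dots> = (\<integral>\<^sup>+z. ennreal a * indicator {0..y} z + ennreal b * indicator {y<..1} z \<partial>lborel)"
    using assms by (intro nn_integral_cong) (auto simp: indicator_def)
  also have "\<dots> = ennreal a * ennreal y + ennreal b * ennreal (1 - y)"
    using assms by (simp add: nn_integral_add nn_integral_cmult)
  also have "\<dots> = ennreal (a * y + b * (1 - y))"
    using assms by (simp add: ennreal_mult ennreal_plus)
  finally show ?thesis .
qed

text \<open>From \<open>1 + t\<close> \<le> \<open>exp t\<close>. The exponent falls short of
  \<open>2 * n\<close> by 2, which costs \<open>exp (2 * (1 - y) / n)\<close>, at most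
  \<open>exp (2 / n)\<close>.\<close>

lemma one_minus_power_le_exp:
  fixes y :: real
  assumes "0 < n" "0 \<le> y" "y \<le> 1"
  shows "(1 - (1 - y) / n) ^ (2 * n - 2) \<le> exp (2 / n) * exp (- 2 * (1 - y))"
proof -
  have nn: "0 \<le> 1 - (1 - y) / n"
    using assms by (simp add: field_simps)
  have "1 - (1 - y) / n \<le> exp (- ((1 - y) / n))"
    using exp_ge_add_one_self[of "- ((1 - y) / n)"] by simp
  then have "(1 - (1 - y) / n) ^ (2 * n - 2) \<le> exp (- ((1 - y) / n)) ^ (2 * n - 2)"
    using nn by (intro power_mono) auto
  also have "\<dots> = exp (real (2 * n - 2) * (- ((1 - y) / n)))"
    by (simp only: exp_of_nat_mult)
  also have "real (2 * n - 2) * (- ((1 - y) / n)) = 2 * (1 - y) / n + - 2 * (1 - y)"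
    using assms by (simp add: of_nat_diff field_simps)
  also have "exp (2 * (1 - y) / n + - 2 * (1 - y)) \<le> exp (2 / n) * exp (- 2 * (1 - y))"
    unfolding exp_add using assms by (intro mult_right_mono) (auto simp: field_simps)
  finally show ?thesis .
qed

lemma nn_integral_unit_mult_exp:
  "(\<integral>\<^sup>+y. ennreal (y * exp (- 2 * (1 - y))) * indicator {0..1::real} y \<partial>lborel)
    = ennreal ((1 + exp (-2)) / 4)"
proof -
  have "(\<integral>\<^sup>+y. ennreal (y * exp (- 2 * (1 - y))) * indicator {0..1::real} y \<partial>lborel)
      = ennreal ((1 / 2 - 1 / 4) * exp (- 2 * (1 - 1)) - (0 / 2 - 1 / 4) * exp (- 2 * (1 - 0)))"
    \<comment> \<open>The antiderivative comes from integration by parts.\<close>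
    by (rule nn_integral_FTC_Icc[where F = "\<lambda>y. (y / 2 - 1 / 4) * exp (- 2 * (1 - y))"])
       (auto intro!: derivative_eq_intros simp: field_simps)
  then show ?thesis
    by (simp add: field_simps)
qed

lemma measurable_arrival_pair:
  fixes q :: real
  assumes "v \<in> V"
  shows "(\<lambda>Y. \<Prod>w\<in>V - {v}. ennreal (if Y w \<le> Y v then 1 else if w = u then 0 else q))
    \<in> borel_measurable (PiM V (\<lambda>_. uniform_measure lborel {0..1::real}))"
    (is "_ \<in> borel_measurable ?P")
proof (rule borel_measurable_prod_ennreal)
  have component: "(\<lambda>Y. Y w) \<in> borel_measurable ?P" if "w \<in> V" for w
  proof -
    have "borel_measurable ?P = (?P \<rightarrow>\<^sub>M uniform_measure lborel {0..1})"
      by (rule measurable_cong_sets) auto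
    then show ?thesis
      using measurable_component_singleton[OF that] by metis
  qed
  fix w assume "w \<in> V - {v}"
  then have [measurable]: "(\<lambda>Y. Y w) \<in> borel_measurable ?P" "(\<lambda>Y. Y v) \<in> borel_measurable ?P"
    using assms by (auto intro: component)
  show "(\<lambda>Y. ennreal (if Y w \<le> Y v then 1 else if w = u then 0 else q)) \<in> borel_measurable ?P"
    by measurable
qed

text \<open>Given \<open>Y v = y\<close>, the factors are independent: the one of \<open>u\<close>
  has mean \<open>y\<close>, and each of the other \<open>2 * n - 2\<close> has mean
  \<open>y + q * (1 - y) = 1 - (1 - y) / n\<close>.\<close>

lemma nn_integral_arrival_pair_le:
  fixes u v n :: nat and q :: real
  assumes n: "0 < n" and q: "q = 1 - 1 / real n"
    and V: "finite V" "card V = 2 * n" and uv: "u \<in> V" "v \<in> V" "u \<noteq> v"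
  shows "(\<integral>\<^sup>+Y. (\<Prod>w\<in>V - {v}. ennreal (if Y w \<le> Y v then 1 else if w = u then 0 else q))
      \<partial>PiM V (\<lambda>_. uniform_measure lborel {0..1::real}))
    \<le> ennreal (exp (2 / n) * ((1 + exp (-2)) / 4))"
proof -
  define U where "U = uniform_measure lborel {0..1::real}"
  interpret U: prob_space U
    unfolding U_def by (rule prob_space_uniform_unit)
  interpret product_sigma_finite "\<lambda>_::nat. U"
    by unfold_locales
  have [measurable_cong]: "sets U = sets borel"
    by (simp add: U_def)
  define I where "I = V - {v}"
  have I: "finite I" "v \<notin> I" "insert v I = V" "u \<in> I" "card (I - {u}) = 2 * n - 2"
    using V uv by (auto simp: I_def card_Diff_subset)
  have q01: "0 \<le> q"
    using n by (simp add: q)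
  let ?c = "\<lambda>w. if w = u then 0 else q"
  have inner: "(\<integral>\<^sup>+Y. (\<Prod>w\<in>I. ennreal (if Y w \<le> y then 1 else ?c w)) \<partial>PiM I (\<lambda>_. U))
      \<le> ennreal (exp (2 / n)) * ennreal (y * exp (- 2 * (1 - y)))" if y: "0 \<le> y" "y \<le> 1" for y
  proof -
    have "(\<integral>\<^sup>+Y. (\<Prod>w\<in>I. ennreal (if Y w \<le> y then 1 else ?c w)) \<partial>PiM I (\<lambda>_. U))
        = (\<Prod>w\<in>I. \<integral>\<^sup>+z. ennreal (if z \<le> y then 1 else ?c w) \<partial>U)"
      by (rule product_nn_integral_prod) (use I in measurable)
    also have "\<dots> = (\<Prod>w\<in>I. ennreal (1 * y + ?c w * (1 - y)))"
      unfolding U_def using y q01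
      by (intro prod.cong refl nn_integral_uniform_unit_threshold) auto
    also have "\<dots> = ennreal (\<Prod>w\<in>I. 1 * y + ?c w * (1 - y))"
      using y q01 by (intro prod_ennreal) auto
    also have "(\<Prod>w\<in>I. 1 * y + ?c w * (1 - y)) = y * (\<Prod>w\<in>I - {u}. 1 - (1 - y) / n)"
      using I by (subst prod.remove[of _ u]) (auto simp: q field_simps intro!: prod.cong)
    also have "\<dots> = y * (1 - (1 - y) / n) ^ (2 * n - 2)"
      using I by simp
    also have "ennreal \<dots> \<le> ennreal (y * (exp (2 / n) * exp (- 2 * (1 - y))))"
      using y n by (intro ennreal_leI mult_left_mono one_minus_power_le_exp)
    also have "\<dots> = ennreal (exp (2 / n)) * ennreal (y * exp (- 2 * (1 - y)))"
      using y by (subst ennreal_mult[symmetric]) (auto simp: mult_ac)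
    finally show ?thesis .
  qed
  have "(\<integral>\<^sup>+Y. (\<Prod>w\<in>I. ennreal (if Y w \<le> Y v then 1 else ?c w)) \<partial>PiM (insert v I) (\<lambda>_. U))
      = (\<integral>\<^sup>+y. (\<integral>\<^sup>+Y. (\<Prod>w\<in>I. ennreal (if (Y(v := y)) w \<le> (Y(v := y)) v then 1 else ?c w))
           \<partial>PiM I (\<lambda>_. U)) \<partial>U)"
  proof (rule product_nn_integral_insert_rev)
    show "(\<lambda>Y. \<Prod>w\<in>I. ennreal (if Y w \<le> Y v then 1 else ?c w))
        \<in> borel_measurable (PiM (insert v I) (\<lambda>_. U))"
      unfolding I(3) unfolding I_def U_def by (rule measurable_arrival_pair[OF uv(2)])
  qed (use I in auto)
  also have "\<dots> = (\<integral>\<^sup>+y. (\<integral>\<^sup>+Y. (\<Prod>w\<in>I. ennreal (if Y w \<le> y then 1 else ?c w))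
           \<partial>PiM I (\<lambda>_. U)) \<partial>U)"
  proof -
    have "(\<Prod>w\<in>I. ennreal (if (Y(v := y)) w \<le> (Y(v := y)) v then 1 else ?c w))
        = (\<Prod>w\<in>I. ennreal (if Y w \<le> y then 1 else ?c w))" for Y :: "nat \<Rightarrow> real" and y
      using I(2) by (intro prod.cong refl) (metis fun_upd_apply)
    then show ?thesis
      by (simp only:)
  qed
  also have "\<dots> \<le> (\<integral>\<^sup>+y. ennreal (exp (2 / n)) * ennreal (y * exp (- 2 * (1 - y))) \<partial>U)"
  proof (rule nn_integral_mono_AE)
    have "AE y in U. y \<in> {0..1}"
      unfolding U_def by (rule AE_uniform_measureI) auto
    then show "AE y in U. (\<integral>\<^sup>+Y. (\<Prod>w\<in>I. ennreal (if Y w \<le> y then 1 else ?c w)) \<partial>PiM I (\<lambda>_. U))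
        \<le> ennreal (exp (2 / n)) * ennreal (y * exp (- 2 * (1 - y)))"
      by eventually_elim (use inner in auto)
  qed
  also have "\<dots> = ennreal (exp (2 / n)) * (\<integral>\<^sup>+y. ennreal (y * exp (- 2 * (1 - y))) \<partial>U)"
    by (rule nn_integral_cmult) measurable
  also have "(\<integral>\<^sup>+y. ennreal (y * exp (- 2 * (1 - y))) \<partial>U) = ennreal ((1 + exp (-2)) / 4)"
    unfolding U_def nn_integral_unit_mult_exp[symmetric]
    by (rule nn_integral_uniform_unit) measurable
  also have "ennreal (exp (2 / n)) * ennreal ((1 + exp (-2)) / 4)
      = ennreal (exp (2 / n) * ((1 + exp (-2)) / 4))"
    by (rule ennreal_mult[symmetric]) (auto simp: add_nonneg_nonneg)
  finally show ?thesis
    unfolding I(3) unfolding I_def U_def .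
qed

section \<open>From the discounted sum to a sum of products\<close>

text \<open>If \<open>Y u\<close> \<le> \<open>Y v\<close>, the factor 0 does not occur and the
  product is exactly the power of \<open>q\<close>. All other \<open>u\<close> contribute
  nonnegative terms.\<close>

lemma discounted_card_le:
  fixes q :: real and Y :: "nat \<Rightarrow> real"
  assumes "finite V" "0 \<le> q"
  shows "q ^ card {w \<in> V. Y v < Y w} * card {u \<in> opposite n v. Y u \<le> Y v}
    \<le> (\<Sum>u\<in>opposite n v. \<Prod>w\<in>V - {v}. if Y w \<le> Y v then 1 else if w = u then 0 else q)"
proof -
  let ?g = "\<lambda>u. \<Prod>w\<in>V - {v}. if Y w \<le> Y v then 1 else if w = u then 0 else q"
  have "q ^ card {w \<in> V. Y v < Y w} = ?g u" if "Y u \<le> Y v" for u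
  proof -
    have "?g u = (\<Prod>w\<in>V - {v}. if Y w \<le> Y v then 1 else q)"
      using that by (intro prod.cong) auto
    also have "\<dots> = q ^ card ((V - {v}) \<inter> - {w. Y w \<le> Y v})"
      using assms by (simp add: prod.If_cases)
    also have "(V - {v}) \<inter> - {w. Y w \<le> Y v} = {w \<in> V. Y v < Y w}"
      by auto
    finally show ?thesis by simp
  qed
  then have "sum ?g {u \<in> opposite n v. Y u \<le> Y v}
      = (\<Sum>u\<in>{u \<in> opposite n v. Y u \<le> Y v}. q ^ card {w \<in> V. Y v < Y w})"
    by (intro sum.cong) auto
  then have "q ^ card {w \<in> V. Y v < Y w} * card {u \<in> opposite n v. Y u \<le> Y v}
      = sum ?g {u \<in> opposite n v. Y u \<le> Y v}"
    by simp
  also have "\<dots> \<le> sum ?g (opposite n v)"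
    using assms by (intro sum_mono2 prod_nonneg) auto
  finally show ?thesis .
qed

text \<open>
  Since the factor of \<open>w = u\<close> is the indicator of \<open>Y u \<le> Y v\<close>, each summand is, conditionally on
  \<open>Y v\<close>, a product of independent factors.
\<close>

definition arrival_bound :: "nat \<Rightarrow> (nat \<Rightarrow> real) \<Rightarrow> ennreal" where
  "arrival_bound n Y = (\<Sum>v<2 * n. \<Sum>u\<in>opposite n v. ennreal (1 / n)
     * (\<Prod>w\<in>{..<2 * n} - {v}. ennreal (if Y w \<le> Y v then 1 else if w = u then 0 else 1 - 1 / n)))"

lemma discounted_sum_le_arrival_bound:
  fixes Y :: "nat \<Rightarrow> real"
  assumes "0 < n"
  shows "ennreal (\<Sum>v<2 * n. (1 - 1 / n) ^ card {w \<in> {..<2 * n}. Y v < Y w}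
           * (card {u \<in> opposite n v. Y u \<le> Y v} / n)) \<le> arrival_bound n Y"
proof -
  let ?V = "{..<2 * n}"
  let ?q = "1 - 1 / real n"
  let ?g = "\<lambda>v u w. if Y w \<le> Y v then 1 else if w = u then 0 else ?q"
  have q0: "0 \<le> ?q"
    using assms by simp
  have g0: "0 \<le> ?g v u w" for v u w
    using q0 by (simp only: split: if_splits) simp
  have "(\<Sum>v<2 * n. ?q ^ card {w \<in> ?V. Y v < Y w} * (card {u \<in> opposite n v. Y u \<le> Y v} / n))
     = (\<Sum>v<2 * n. (1 / n) * (?q ^ card {w \<in> ?V. Y v < Y w} * card {u \<in> opposite n v. Y u \<le> Y v}))"
    by simp
  also have "\<dots> \<le> (\<Sum>v<2 * n. (1 / n) * (\<Sum>u\<in>opposite n v. \<Prod>w\<in>?V - {v}. ?g v u w))"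
    using q0 by (intro sum_mono mult_left_mono discounted_card_le) auto
  also have "\<dots> = (\<Sum>v<2 * n. \<Sum>u\<in>opposite n v. (1 / n) * (\<Prod>w\<in>?V - {v}. ?g v u w))"
    by (simp only: sum_distrib_left)
  finally have "ennreal (\<Sum>v<2 * n. ?q ^ card {w \<in> ?V. Y v < Y w}
         * (card {u \<in> opposite n v. Y u \<le> Y v} / n))
      \<le> ennreal (\<Sum>v<2 * n. \<Sum>u\<in>opposite n v. (1 / n) * (\<Prod>w\<in>?V - {v}. ?g v u w))"
    by (rule ennreal_leI)
  also have "\<dots> = (\<Sum>v<2 * n. ennreal (\<Sum>u\<in>opposite n v. (1 / n) * (\<Prod>w\<in>?V - {v}. ?g v u w)))"
    by (intro sum_ennreal[symmetric] sum_nonneg mult_nonneg_nonneg prod_nonneg g0) simp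
  also have "\<dots> = (\<Sum>v<2 * n. \<Sum>u\<in>opposite n v. ennreal ((1 / n) * (\<Prod>w\<in>?V - {v}. ?g v u w)))"
    by (intro sum.cong refl sum_ennreal[symmetric] mult_nonneg_nonneg prod_nonneg g0) simp
  also have "\<dots> = (\<Sum>v<2 * n. \<Sum>u\<in>opposite n v. ennreal (1 / n) * ennreal (\<Prod>w\<in>?V - {v}. ?g v u w))"
    by (intro sum.cong refl ennreal_mult prod_nonneg g0) simp
  also have "\<dots> = arrival_bound n Y"
    unfolding arrival_bound_def by (subst prod_ennreal) (auto intro: g0)
  finally show ?thesis .
qed

lemma measurable_arrival_bound:
  "arrival_bound n \<in> borel_measurable (PiM {..<2 * n} (\<lambda>_. uniform_measure lborel {0..1::real}))"
  unfolding arrival_bound_def[abs_def]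
  by (intro borel_measurable_sum borel_measurable_times_ennreal borel_measurable_const
      measurable_arrival_pair)

text \<open>There are \<open>2 * n\<close> choices of \<open>v\<close> and \<open>n\<close> of
  \<open>u\<close>, each with weight \<open>1 / n\<close>, so the pair bound is multiplied by
  \<open>2 * n\<close>.\<close>

lemma nn_integral_arrival_bound_le:
  assumes n: "0 < n"
  shows "(\<integral>\<^sup>+Y. arrival_bound n Y \<partial>PiM {..<2 * n} (\<lambda>_. uniform_measure lborel {0..1::real}))
    \<le> ennreal (n * (exp (2 / n) * ((1 + exp (-2)) / 2)))"
proof -
  let ?V = "{..<2 * n}"
  let ?P = "PiM ?V (\<lambda>_. uniform_measure lborel {0..1::real})"
  let ?g = "\<lambda>Y v u. \<Prod>w\<in>?V - {v}. ennreal (if Y w \<le> Y v then 1 else if w = u then 0 else 1 - 1 / real n)"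
  let ?K = "exp (2 / n) * ((1 + exp (-2)) / 4) :: real"
  have "(\<integral>\<^sup>+Y. arrival_bound n Y \<partial>?P)
      = (\<Sum>v<2 * n. \<integral>\<^sup>+Y. (\<Sum>u\<in>opposite n v. ennreal (1 / n) * ?g Y v u) \<partial>?P)"
    unfolding arrival_bound_def
    by (intro nn_integral_sum borel_measurable_sum borel_measurable_times_ennreal
        borel_measurable_const measurable_arrival_pair)
  also have "\<dots> = (\<Sum>v<2 * n. \<Sum>u\<in>opposite n v. \<integral>\<^sup>+Y. ennreal (1 / n) * ?g Y v u \<partial>?P)"
    by (intro sum.cong refl nn_integral_sum borel_measurable_times_ennreal
        borel_measurable_const measurable_arrival_pair)
  also have "\<dots> = (\<Sum>v<2 * n. \<Sum>u\<in>opposite n v. ennreal (1 / n) * (\<integral>\<^sup>+Y. ?g Y v u \<partial>?P))"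
    by (intro sum.cong refl nn_integral_cmult measurable_arrival_pair)
  also have "\<dots> \<le> (\<Sum>v<2 * n. \<Sum>u\<in>opposite n v. ennreal (1 / n) * ennreal ?K)"
    using opposite_bound by (intro sum_mono mult_left_mono nn_integral_arrival_pair_le n refl) auto
  also have "\<dots> = (\<Sum>v<2 * n. \<Sum>u\<in>opposite n v. ennreal ((1 / n) * ?K))"
    by (intro sum.cong refl ennreal_mult[symmetric]) (auto simp: add_nonneg_nonneg)
  also have "\<dots> = ennreal (\<Sum>v<2 * n. \<Sum>u\<in>opposite n v. (1 / n) * ?K)"
    by (subst sum_ennreal | simp add: add_nonneg_nonneg)+
  also have "(\<Sum>v<2 * n. \<Sum>u\<in>opposite n v. (1 / n) * ?K) = n * (exp (2 / n) * ((1 + exp (-2)) / 2))"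
    using n by simp
  finally show ?thesis .
qed

section \<open>The bound on the selectability constant\<close>

lemma selectable_biclique_le:
  fixes A :: "'s scheme" and n :: nat
  assumes A: "rcrs A" "selectable_on \<alpha> A bipartite_class" and n: "0 < n"
  shows "\<alpha> \<le> exp (2 / n) * ((1 + exp (-2)) / 2)"
proof -
  define V where "V = {..<2 * n}"
  define E where "E = biclique n"
  define x where "x = (\<lambda>e\<in>E. 1 / real n)"
  define a where "a = A V E x"
  define q where "q = 1 - 1 / real n"
  define S where "S = seed_space a"
  define PF where "PF = PiM V (\<lambda>v. measure_pmf (choice_pmf E x v))"
  define PY where "PY = PiM V (\<lambda>_. uniform_measure lborel {0..1::real})"
  define P where "P = prob_model V E x S"
  have VE: "graph V E" "bipartite V E" "fractional_matching V E x"
    unfolding V_def E_def x_def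
    using n by (auto intro: graph_biclique bipartite_biclique fractional_matching_biclique)
  have finE: "finite E"
    by (simp add: E_def)
  have P_eq: "P = PF \<Otimes>\<^sub>M (PY \<Otimes>\<^sub>M S)"
    by (simp add: P_def prob_model_def PF_def PY_def)
  have S: "prob_space S" and sel: "selected V E a \<in> P \<rightarrow>\<^sub>M count_space (Pow E)"
    using A(1) VE unfolding rcrs_def S_def a_def P_def by auto
  interpret S: prob_space S by fact
  interpret PF: prob_space PF
    unfolding PF_def by (rule prob_space_PiM) (rule prob_space_measure_pmf)
  interpret PY: prob_space PY
    unfolding PY_def by (rule prob_space_PiM) (rule prob_space_uniform_unit)
  interpret YS: prob_space "PY \<Otimes>\<^sub>M S"
    by (rule prob_space_pair) unfold_locales
  interpret P: prob_space P
    unfolding P_eq by (rule prob_space_pair) unfold_locales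
  interpret pair_sigma_finite PF "PY \<Otimes>\<^sub>M S" ..
  have card_meas: "(\<lambda>\<omega>. ennreal (card (selected V E a \<omega>))) \<in> borel_measurable P"
    using measurable_compose[OF sel, of "\<lambda>M. ennreal (card M)" borel] by simp
  have event: "{\<omega> \<in> space P. e \<in> selected V E a \<omega>} \<in> sets P" for e
  proof -
    have "selected V E a -` {M \<in> Pow E. e \<in> M} \<inter> space P \<in> sets P"
      by (rule measurable_sets[OF sel]) auto
    also have "selected V E a -` {M \<in> Pow E. e \<in> M} \<inter> space P = {\<omega> \<in> space P. e \<in> selected V E a \<omega>}"
      using measurable_space[OF sel] by auto
    finally show ?thesis .
  qed
  \<comment> \<open>Selectability is summed over the \<open>n * n\<close> edges of weight
    \<open>1 / n\<close>; by linearity the right side becomes the expected size of the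
    matching.\<close>
  have "ennreal (\<alpha> * n) \<le> ennreal (\<Sum>e\<in>E. measure P {\<omega> \<in> space P. e \<in> selected V E a \<omega>})"
  proof (rule ennreal_leI)
    have "(V, E, x) \<in> bipartite_class"
      using VE by (simp add: bipartite_class_def)
    then have "\<alpha> * x e \<le> measure P {\<omega> \<in> space P. e \<in> selected V E a \<omega>}" if "e \<in> E" for e
      using A(2) that unfolding selectable_on_def P_def S_def a_def by blast
    then have "(\<Sum>e\<in>E. \<alpha> * x e) \<le> (\<Sum>e\<in>E. measure P {\<omega> \<in> space P. e \<in> selected V E a \<omega>})"
      by (rule sum_mono)
    moreover have "(\<Sum>e\<in>E. \<alpha> * x e) = \<alpha> * n"
      using n card_biclique[of n] by (simp add: x_def E_def)
    ultimately show "\<alpha> * n \<le> (\<Sum>e\<in>E. measure P {\<omega> \<in> space P. e \<in> selected V E a \<omega>})"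
      by simp
  qed
  also have "\<dots> = (\<Sum>e\<in>E. emeasure P {\<omega> \<in> space P. e \<in> selected V E a \<omega>})"
    by (simp add: P.emeasure_eq_measure)
  also have "\<dots> = (\<Sum>e\<in>E. \<integral>\<^sup>+\<omega>. indicator {\<omega> \<in> space P. e \<in> selected V E a \<omega>} \<omega> \<partial>P)"
    using event by simp
  also have "\<dots> = (\<integral>\<^sup>+\<omega>. (\<Sum>e\<in>E. indicator {\<omega> \<in> space P. e \<in> selected V E a \<omega>} \<omega>) \<partial>P)"
    using event by (intro nn_integral_sum[symmetric]) auto
  also have "\<dots> = (\<integral>\<^sup>+\<omega>. ennreal (card (selected V E a \<omega>)) \<partial>P)"
  proof (rule nn_integral_cong)
    fix \<omega> assume \<omega>: "\<omega> \<in> space P"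
    then have "selected V E a \<omega> \<subseteq> E"
      using measurable_space[OF sel] by auto
    then have "(\<Sum>e\<in>E. of_bool (e \<in> selected V E a \<omega>)) = ennreal (card (selected V E a \<omega>))"
      using finE by (simp add: sum_of_bool_eq Int_absorb1 Int_def[symmetric] ennreal_of_nat_eq_real_of_nat)
    then show "(\<Sum>e\<in>E. indicator {\<omega> \<in> space P. e \<in> selected V E a \<omega>} \<omega>)
        = ennreal (card (selected V E a \<omega>))"
      using \<omega> by (simp add: indicator_def)
  qed
  \<comment> \<open>The choices are integrated first, with times and seed fixed, so that
    \<open>accept a s\<close> is a deterministic rule and \<open>expected_card_run_le\<close>
    applies.\<close>
  also have "\<dots> = (\<integral>\<^sup>+z. (\<integral>\<^sup>+F. ennreal (card (selected V E a (F, z))) \<partial>PF) \<partial>(PY \<Otimes>\<^sub>M S))"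
    using card_meas unfolding P_eq by (rule nn_integral_snd[symmetric])
  also have "\<dots> \<le> (\<integral>\<^sup>+z. arrival_bound n (fst z) \<partial>(PY \<Otimes>\<^sub>M S))"
  proof (rule nn_integral_mono)
    fix z :: "(nat \<Rightarrow> real) \<times> 's"
    obtain Y s where z: "z = (Y, s)"
      by (cases z)
    define vs where "vs = sort_key Y (sorted_list_of_set V)"
    have vs: "set vs = V" "distinct vs" "sorted (map Y vs)"
      by (auto simp: vs_def V_def)
    have "(\<integral>\<^sup>+F. ennreal (card (run (accept a s) []
             (map (\<lambda>v. (v, Y v, active_earlier (biclique n) F Y v)) vs) {}))
           \<partial>PiM (set vs) (\<lambda>v. measure_pmf (choice_pmf E x v)))
       \<le> ennreal (q ^ length vs * card ({} :: nat set set)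
        + (\<Sum>v\<in>set vs. q ^ card {w \<in> set vs. Y v < Y w}
             * (card {u \<in> opposite n v. Y u \<le> Y v} / n)))"
    proof (rule expected_card_run_le)
      show "pmf (choice_pmf E x v) (Some u) \<le> 1 / real n" if "v \<in> set vs" for v u
        using that n vs(1) unfolding E_def x_def by (intro pmf_choice_biclique) (auto simp: V_def)
    qed (use n vs in \<open>auto simp: q_def matching_def\<close>)
    \<comment> \<open>The run starts from the empty matching, so the term with
      \<open>q ^ length vs\<close> vanishes.\<close>
    also have "\<dots> \<le> arrival_bound n Y"
      using discounted_sum_le_arrival_bound[OF n, of Y] by (simp add: vs(1) V_def q_def)
    finally show "(\<integral>\<^sup>+F. ennreal (card (selected V E a (F, z))) \<partial>PF) \<le> arrival_bound n (fst z)"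
      by (simp add: z selected_def arrivals_def PF_def vs(1) vs_def[symmetric] E_def[symmetric])
  qed
  also have "\<dots> = (\<integral>\<^sup>+Y. arrival_bound n Y \<partial>PY)"
  proof -
    have "arrival_bound n \<in> borel_measurable PY"
      unfolding PY_def V_def by (rule measurable_arrival_bound)
    then have "(\<lambda>z. arrival_bound n (fst z)) \<in> borel_measurable (PY \<Otimes>\<^sub>M S)"
      by (rule measurable_compose[OF measurable_fst])
    then show ?thesis
      \<comment> \<open>The bound does not involve the seed, and \<open>S\<close> has total mass
        1.\<close>
      by (subst S.nn_integral_fst[symmetric]) (simp_all add: S.emeasure_space_1)
  qed
  also have "\<dots> \<le> ennreal (n * (exp (2 / n) * ((1 + exp (-2)) / 2)))"
    unfolding PY_def V_def by (rule nn_integral_arrival_bound_le[OF n])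
  finally have "\<alpha> * n \<le> n * (exp (2 / n) * ((1 + exp (-2)) / 2))"
    by (subst (asm) ennreal_le_iff) (auto simp: add_nonneg_nonneg)
  then show ?thesis
    using n by (simp add: mult.commute)
qed

theorem theorem3:
  fixes \<alpha> :: real
  assumes "\<alpha> > (1 + exp (-2)) / 2"
  shows "\<not> (\<exists>A :: 's scheme. rcrs A \<and> selectable_on \<alpha> A bipartite_class)"
proof
  assume "\<exists>A :: 's scheme. rcrs A \<and> selectable_on \<alpha> A bipartite_class"
  then obtain A :: "'s scheme" where A: "rcrs A" "selectable_on \<alpha> A bipartite_class"
    by blast
  have "(\<lambda>n. exp (2 / real n) * ((1 + exp (-2)) / 2)) \<longlonglongrightarrow> exp 0 * ((1 + exp (-2)) / 2)"
    by (intro tendsto_intros lim_const_over_n)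
  \<comment> \<open>The same scheme \<open>A\<close> serves all instances, so it obeys the bound for
    every positive \<open>n\<close>.\<close>
  moreover have "\<forall>\<^sub>F n in sequentially. \<alpha> \<le> exp (2 / real n) * ((1 + exp (-2)) / 2)"
    using eventually_gt_at_top[of 0] by eventually_elim (rule selectable_biclique_le[OF A])
  ultimately have "\<alpha> \<le> exp 0 * ((1 + exp (-2)) / 2)"
    by (intro tendsto_lowerbound) auto
  then show False
    using assms by simp
qed

end
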